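(* Let $\mathbb{F}$ be an arbitrary field and let $P(\lambda)=\sum_{k=0}^dP_k\lambda^k\in\mathbb{F}[\lambda]^{n\times n}$ be a regular matrix polynomial of even degree $d\ge2$ with nonsingular trailing coefficient $P_0$, and let $t=d/2$. Let $\widetilde{\mathcal{L}}(\lambda)$ be a strong linearization of $\mathrm{rev}\,P(\lambda)=\lambda^dP(\lambda^{-1})$ obtained from a modified block Kronecker pencil, i.e. $$\widetilde{\mathcal{L}}(\lambda)=\begin{bmatrix}\lambda B+A&\widehat{L}_t(\lambda)^T\otimes I_n\\ \sigma\widehat{L}_t(\lambda)\otimes I_n&0\end{bmatrix},\qquad\sigma\in\{1,-1\},$$ where $\lambda B+A$ is a $(t+1)n\times(t+1)n$ pencil over $\mathbb{F}$ satisfying $$(\widehat{\Lambda}_t(\lambda)^T\otimes I_n)(\lambda B+A)(\widehat{\Lambda}_t(\lambda)\otimes I_n)=\begin{bmatrix}-P_0&\lambda^tP_0\\ \lambda^tP_0&\mathrm{rev}\,P(\lambda)-\lambda^dP_0\end{bmatrix},$$ and let $\mathcal{L}(\lambda)=\mathrm{rev}_1\widetilde{\mathcal{L}}(\lambda)=\lambda\widetilde{\mathcal{L}}(\lambda^{-1})$, which is a strong linearization of $P(\lambda)$. Then: (a) If $z\in\mathbb{F}^{nd\times1}$ is a right eigenvector of $\mathcal{L}(\lambda)$ with nonzero finite eigenvalue $\lambda_0$, then the $(t+1)$th block of $z$ is a right eigenvector of $P(\lambda)$ with finite eigenvalue $\lambda_0$. (b) If $z\in\mathbb{F}^{nd\times1}$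 is a right eigenvector of $\mathcal{L}(\lambda)$ for the eigenvalue $\infty$, then the $(t+1)$th block of $z$ is a right eigenvector of $P(\lambda)$ for the eigenvalue $\infty$.
   Context: $\widehat{L}_k(\lambda)\in\mathbb{F}[\lambda]^{(k-1)\times(k+1)}$ is the matrix whose first column is zero and whose $(i,i+1)$ entries are $-1$ and $(i,i+2)$ entries are $\lambda$ ($i=1,\dots,k-1$), all other entries being zero (for $k=1$ it is an empty $0\times 2$ matrix). $\widehat{\Lambda}_k(\lambda)^T=\begin{bmatrix}1&0&\cdots&0&0\\0&\lambda^{k-1}&\cdots&\lambda&1\end{bmatrix}\in\mathbb{F}[\lambda]^{2\times(k+1)}$. A square matrix polynomial is regular if its determinant is not identically zero. A pencil $L(\lambda)=\lambda X+Y$ is a linearization of $P(\lambda)$ if there exist unimodular matrix polynomials $U(\lambda),V(\lambda)$ with $U(\lambda)L(\lambda)V(\lambda)=\mathrm{diag}(I_m,P(\lambda))$ for some natural number $m$; it is a strong linearization of $P(\lambda)$ (of degree $d$) if in addition $\lambda Y+X$ is a linearization of $\lambda^dP(\lambda^{-1})$. Column vectors of size $nd$ are partitioned into $d$ consecutive blocks of size $n$. A right eigenvector of a regular matrix polynomial $R(\lambda)$ with finite eigenvalue $\lambda_0\in\overline{\mathbb{F}}$ is a nonzero vector $x$ with $R(\lambda_0)x=0$. A right eigenvector of $P(\lambda)$ (resp. of the pencil $\mathcal{L}(\lambda)$) for the eigenvalue $\infty$ is a nonzero vector $x$ annihilated by the value at $\lambda=0$ of $\lambda^dP(\lambda^{-1})$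 (resp. of $\lambda\mathcal{L}(\lambda^{-1})$). *)

theory Defs
  imports
    "Jordan_Normal_Form.Determinant"
    "HOL-Algebra.Algebraic_Closure_Type"
begin

hide_const (open) up_ring.coeff up_ring.monom Polynomials.degree
no_notation var (\<open>X\<index>\<close>)

text \<open>A matrix polynomial over a field is a matrix whose entries are univariate polynomials.\<close>

definition const_mat :: "'a :: comm_ring_1 mat \<Rightarrow> 'a poly mat" where
  "const_mat A = map_mat (\<lambda>a. [:a:]) A"

definition coeff_mat :: "'a :: comm_ring_1 poly mat \<Rightarrow> nat \<Rightarrow> 'a mat" where
  "coeff_mat P k = map_mat (\<lambda>p. coeff p k) P"

definition pencil :: "'a :: comm_ring_1 mat \<Rightarrow> 'a mat \<Rightarrow> 'a poly mat" where
  "pencil X Y = [:0, 1:] \<cdot>\<^sub>m const_mat X + const_mat Y"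

text \<open>The largest \<open>k\<close> whose coefficient matrix is nonzero; \<open>0\<close> for zero and empty matrices.\<close>

definition mat_poly_degree :: "'a :: comm_ring_1 poly mat \<Rightarrow> nat" where
  "mat_poly_degree P = Max (insert 0 (degree ` elements_mat P))"

definition regular_mat_poly :: "'a :: field poly mat \<Rightarrow> bool" where
  "regular_mat_poly P \<longleftrightarrow> square_mat P \<and> det P \<noteq> 0"

text \<open>The reversal \<open>\<lambda>\<^sup>g P(1/\<lambda>)\<close>, meaningful when all entries of \<open>P\<close> have degree at most \<open>g\<close>.\<close>

definition poly_rev :: "nat \<Rightarrow> 'a :: comm_ring_1 poly \<Rightarrow> 'a poly" where
  "poly_rev g p = (\<Sum>k\<le>g. monom (coeff p k) (g - k))"

definition mat_poly_rev :: "nat \<Rightarrow> 'a :: comm_ring_1 poly mat \<Rightarrow> 'a poly mat" where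
  "mat_poly_rev g P = map_mat (poly_rev g) P"

definition kronecker :: "'a :: comm_ring_1 mat \<Rightarrow> 'a mat \<Rightarrow> 'a mat" (infixl "\<otimes>\<^sub>K" 70) where
  "A \<otimes>\<^sub>K B = mat (dim_row A * dim_row B) (dim_col A * dim_col B)
     (\<lambda>(i, j). A $$ (i div dim_row B, j div dim_col B) * B $$ (i mod dim_row B, j mod dim_col B))"

text \<open>Matrix indices start at 0, so the 1-based entries \<open>(i, i+1)\<close> and \<open>(i, i+2)\<close>
  of the usual description keep their form, with \<open>i\<close> now running over \<open>0, \<dots>, k-2\<close>.\<close>

definition L_hat :: "nat \<Rightarrow> 'a :: field poly mat" where
  "L_hat k = mat (k - 1) (k + 1)
     (\<lambda>(i, j). if j = i + 1 then -1 else if j = i + 2 then [:0, 1:] else 0)"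

text \<open>The transpose of the \<open>(k+1) \<times> 2\<close> matrix with rows
  \<open>(1, 0), (0, \<lambda>\<^bsup>k-1\<^esup>), \<dots>, (0, \<lambda>), (0, 1)\<close>.\<close>

definition Lambda_hat_T :: "nat \<Rightarrow> 'a :: field poly mat" where
  "Lambda_hat_T k = mat 2 (k + 1)
     (\<lambda>(i, j). if i = 0 then (if j = 0 then 1 else 0)
               else (if j = 0 then 0 else monom 1 (k - j)))"

definition Lambda_hat :: "nat \<Rightarrow> 'a :: field poly mat" where
  "Lambda_hat k = transpose_mat (Lambda_hat_T k)"

definition unimodular :: "'a :: field poly mat \<Rightarrow> bool" where
  "unimodular U \<longleftrightarrow> square_mat U \<and> (\<exists>c. c \<noteq> 0 \<and> det U = [:c:])"

text \<open>The carrier conditions only ensure that the product \<open>U * L * V\<close> is well-formed.\<close>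

definition is_linearization ::
  "'a :: field mat \<Rightarrow> 'a mat \<Rightarrow> 'a poly mat \<Rightarrow> bool" where
  "is_linearization X Y P \<longleftrightarrow>
     (\<exists>m U V. let r = m + dim_row P; c = m + dim_col P in
        X \<in> carrier_mat r c \<and> Y \<in> carrier_mat r c \<and>
        U \<in> carrier_mat r r \<and> V \<in> carrier_mat c c \<and>
        unimodular U \<and> unimodular V \<and>
        U * pencil X Y * V =
          four_block_mat (1\<^sub>m m) (0\<^sub>m m (dim_col P)) (0\<^sub>m (dim_row P) m) P)"

definition is_strong_linearization :: "'a :: field poly mat \<Rightarrow> 'a poly mat \<Rightarrow> bool" where
  "is_strong_linearization L P \<longleftrightarrow>
     (\<exists>X Y. L = pencil X Y \<and> is_linearization X Y P \<and>
        is_linearization Y X (mat_poly_rev (mat_poly_degree P) P))"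

definition eval_mat_poly ::
  "'a :: field poly mat \<Rightarrow> 'a alg_closure \<Rightarrow> 'a alg_closure mat" where
  "eval_mat_poly R c = map_mat (\<lambda>p. poly (map_poly to_ac p) c) R"

text \<open>Eigenvalues and eigenvectors live in the algebraic closure of the base field.
  The notion is intended for regular \<open>R\<close>.\<close>

definition right_eigenvector ::
  "'a :: field poly mat \<Rightarrow> 'a alg_closure \<Rightarrow> 'a alg_closure vec \<Rightarrow> bool" where
  "right_eigenvector R c x \<longleftrightarrow>
     x \<in> carrier_vec (dim_col R) \<and> x \<noteq> 0\<^sub>v (dim_col R) \<and>
     eval_mat_poly R c *\<^sub>v x = 0\<^sub>v (dim_row R)"

text \<open>Eigenvectors for the eigenvalue \<open>\<infinity>\<close>, where \<open>g\<close> is the degree used for the reversal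
  (\<open>1\<close> for a pencil).\<close>

definition right_eigenvector_inf ::
  "nat \<Rightarrow> 'a :: field poly mat \<Rightarrow> 'a alg_closure vec \<Rightarrow> bool" where
  "right_eigenvector_inf g R x \<longleftrightarrow> right_eigenvector (mat_poly_rev g R) 0 x"

text \<open>The \<open>k\<close>-th block of size \<open>n\<close>, with blocks numbered from 1.\<close>

definition vec_block :: "nat \<Rightarrow> nat \<Rightarrow> 'a vec \<Rightarrow> 'a vec" where
  "vec_block n k z = vec n (\<lambda>i. z $ ((k - 1) * n + i))"

end

theory Submission
  imports Defs "Jordan_Normal_Form.Char_Poly"
begin

text \<open>
  Reversing twice turns an eigenvector of \<open>L\<close> for \<open>\<mu> \<noteq> 0\<close> (or for \<open>\<infinity>\<close>) into a null vector \<open>z\<close> of the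
  modified block Kronecker pencil at \<open>c = 1/\<mu>\<close> (or at \<open>c = 0\<close>), so both parts are the same assertion
  about \<open>rev P\<close> at \<open>c\<close>. Write \<open>z = (x, y)\<close> with \<open>x\<close> consisting of \<open>t + 1\<close> blocks. The second block
  row forces \<open>x = (\<Lambda>(c) \<otimes> I) (x\<^sub>1, x\<^bsub>t+1\<^esub>)\<close>, and multiplying the first block row by
  \<open>\<Lambda>(c)\<^sup>T \<otimes> I\<close> kills \<open>y\<close> and leaves
  \<open>P\<^sub>0 x\<^sub>1 = c\<^sup>t P\<^sub>0 x\<^bsub>t+1\<^esub>\<close> and \<open>c\<^sup>t P\<^sub>0 x\<^sub>1 + (rev P)(c) x\<^bsub>t+1\<^esub> - c\<^sup>d P\<^sub>0 x\<^bsub>t+1\<^esub> = 0\<close>.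
  As \<open>d = 2t\<close>, this gives \<open>(rev P)(c) x\<^bsub>t+1\<^esub> = 0\<close>. If \<open>x\<^bsub>t+1\<^esub>\<close> vanished, then so would \<open>x\<^sub>1\<close>, hence
  \<open>x\<close>, and finally \<open>y\<close>, because \<open>L_hat\<^sup>T\<close> has full column rank at every point.
\<close>

section \<open>Kronecker products with an identity matrix\<close>

text \<open>Stacking the \<open>k\<close>-th entries of all blocks of size \<open>n\<close> reduces \<open>A \<otimes> I\<^sub>n\<close> to \<open>A\<close>.\<close>

definition stride :: "nat \<Rightarrow> nat \<Rightarrow> 'a vec \<Rightarrow> 'a vec" where
  "stride n k v = vec (dim_vec v div n) (\<lambda>i. v $ (i * n + k))"

lemma nat_block_less:
  fixes i m k n :: nat
  assumes "i < m" "k < n"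
  shows "i * n + k < m * n"
proof -
  have "i * n + k < Suc i * n" using assms(2) by simp
  also have "\<dots> \<le> m * n" using assms(1) by (intro mult_le_mono1) simp
  finally show ?thesis .
qed

lemma stride_carrier:
  assumes "v \<in> carrier_vec (m * n)" "k < n"
  shows "stride n k v \<in> carrier_vec m"
proof -
  have "dim_vec v div n = m" using carrier_vecD[OF assms(1)] assms(2) by simp
  then show ?thesis by (simp add: stride_def)
qed

lemma index_stride:
  assumes "v \<in> carrier_vec (m * n)" "i < m" "k < n"
  shows "stride n k v $ i = v $ (i * n + k)"
proof -
  have "dim_vec v div n = m" using carrier_vecD[OF assms(1)] assms(3) by simp
  then show ?thesis using assms(2) by (simp add: stride_def)
qed

lemma stride_zero:
  assumes "k < n" shows "stride n k (0\<^sub>v (m * n)) = 0\<^sub>v m"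
proof (rule eq_vecI)
  show "dim_vec (stride n k (0\<^sub>v (m * n))) = dim_vec (0\<^sub>v m)"
    using assms by (simp add: stride_def)
  fix i assume "i < dim_vec (0\<^sub>v m)"
  then have "i < m" by simp
  then show "stride n k (0\<^sub>v (m * n)) $ i = 0\<^sub>v m $ i"
    using index_stride[OF zero_carrier_vec _ assms] nat_block_less[OF _ assms]
    by (simp only: index_zero_vec)
qed

text \<open>Every index \<open>q\<close> is \<open>q div n * n + q mod n\<close>, so the strides for
  \<open>k < n\<close> together see each entry. A stride equation can thus be lifted to whole
  vectors.\<close>

lemma eq_vec_if_stride_eq:
  assumes "v \<in> carrier_vec (m * n)" "w \<in> carrier_vec (m * n)"
    and "\<And>k. k < n \<Longrightarrow> stride n k v = stride n k w"
  shows "v = w"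
proof (rule eq_vecI)
  fix q assume "q < dim_vec w"
  then have q: "q < m * n" using assms by auto
  then have n: "0 < n" by (cases n) auto
  have d: "q div n < m" using q by (rule less_mult_imp_div_less)
  have r: "q mod n < n" using n by simp
  have "v $ (q div n * n + q mod n) = w $ (q div n * n + q mod n)"
    using assms(3)[OF r] index_stride[OF assms(1) d r] index_stride[OF assms(2) d r] by argo
  then show "v $ q = w $ q" by (simp only: div_mult_mod_eq)
qed (use assms in auto)

lemma kronecker_carrier:
  "A \<in> carrier_mat r c \<Longrightarrow> B \<in> carrier_mat r' c' \<Longrightarrow> A \<otimes>\<^sub>K B \<in> carrier_mat (r * r') (c * c')"
  by (auto simp: kronecker_def)

text \<open>In row \<open>i * n + k\<close>, the j-th group of \<open>n\<close> columns has at most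
  one nonzero entry, namely \<open>A $$ (i, j)\<close> at offset \<open>k\<close>, because the
  second factor is an identity.\<close>

lemma stride_kronecker_one:
  fixes A :: "'a :: comm_ring_1 mat"
  assumes A: "A \<in> carrier_mat r c" and v: "v \<in> carrier_vec (c * n)" and k: "k < n"
  shows "stride n k ((A \<otimes>\<^sub>K 1\<^sub>m n) *\<^sub>v v) = A *\<^sub>v stride n k v"
proof (rule eq_vecI)
  have K: "A \<otimes>\<^sub>K 1\<^sub>m n \<in> carrier_mat (r * n) (c * n)"
    using kronecker_carrier[OF A] by simp
  have Kv: "(A \<otimes>\<^sub>K 1\<^sub>m n) *\<^sub>v v \<in> carrier_vec (r * n)"
    using K v by simp
  show "dim_vec (stride n k ((A \<otimes>\<^sub>K 1\<^sub>m n) *\<^sub>v v)) = dim_vec (A *\<^sub>v stride n k v)"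
    using stride_carrier[OF Kv k] A by simp
  fix i assume "i < dim_vec (A *\<^sub>v stride n k v)"
  then have i: "i < r" using A by simp
  let ?f = "\<lambda>q. (A \<otimes>\<^sub>K 1\<^sub>m n) $$ (i * n + k, q) * v $ q"
  have ik: "i * n + k < r * n" using i k by (rule nat_block_less)
  have "stride n k ((A \<otimes>\<^sub>K 1\<^sub>m n) *\<^sub>v v) $ i = (\<Sum>q<c * n. ?f q)"
    using index_stride[OF Kv i k] K v ik
    by (auto simp: mult_mat_vec_def scalar_prod_def atLeast0LessThan intro!: sum.cong)
  \<comment> \<open>The column range is cut into \<open>c\<close> consecutive groups of length
    \<open>n\<close>.\<close>
  also have "\<dots> = (\<Sum>j<c. sum ?f {j * n..<j * n + n})"
    by (simp add: sum.nat_group)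
  also have "\<dots> = (\<Sum>j<c. A $$ (i, j) * v $ (j * n + k))"
  proof (rule sum.cong[OF refl])
    fix j assume j: "j \<in> {..<c}"
    have "?f q = 0" if q: "q \<in> {j * n..<j * n + n} - {j * n + k}" for q
    proof -
      define l where "l = q - j * n"
      have l: "q = j * n + l" "l < n" "l \<noteq> k" using q by (auto simp: l_def)
      have "q < c * n" using nat_block_less[of j c l n] j l by simp
      then show ?thesis using l k i j A ik by (simp add: kronecker_def)
    qed
    then have "sum ?f {j * n..<j * n + n} = sum ?f {j * n + k}"
      using k by (intro sum.mono_neutral_right) auto
    also have "\<dots> = A $$ (i, j) * v $ (j * n + k)"
      using nat_block_less[of j c k n] i j k A ik by (simp add: kronecker_def)
    finally show "sum ?f {j * n..<j * n + n} = A $$ (i, j) * v $ (j * n + k)" .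
  qed
  also have "\<dots> = (A *\<^sub>v stride n k v) $ i"
    using A i k v stride_carrier[OF v k] index_stride[OF v _ k]
    by (auto simp: mult_mat_vec_def scalar_prod_def atLeast0LessThan intro!: sum.cong)
  finally show "stride n k ((A \<otimes>\<^sub>K 1\<^sub>m n) *\<^sub>v v) $ i = (A *\<^sub>v stride n k v) $ i" .
qed

text \<open>Kernel questions about the Kronecker product split into \<open>n\<close> independent
  copies of the same question about \<open>A\<close>.\<close>

lemma kronecker_one_mult_vec_eq_0_iff:
  fixes A :: "'a :: comm_ring_1 mat"
  assumes "A \<in> carrier_mat r c" "v \<in> carrier_vec (c * n)"
  shows "(A \<otimes>\<^sub>K 1\<^sub>m n) *\<^sub>v v = 0\<^sub>v (r * n) \<longleftrightarrow> (\<forall>k<n. A *\<^sub>v stride n k v = 0\<^sub>v r)"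
proof -
  have "(A \<otimes>\<^sub>K 1\<^sub>m n) *\<^sub>v v \<in> carrier_vec (r * n)"
    using kronecker_carrier[OF assms(1), of "1\<^sub>m n" n n] assms(2) by simp
  then have "(A \<otimes>\<^sub>K 1\<^sub>m n) *\<^sub>v v = 0\<^sub>v (r * n) \<longleftrightarrow>
      (\<forall>k<n. stride n k ((A \<otimes>\<^sub>K 1\<^sub>m n) *\<^sub>v v) = stride n k (0\<^sub>v (r * n)))"
    using eq_vec_if_stride_eq[of _ r n "0\<^sub>v (r * n)"] by auto
  then show ?thesis
    using stride_kronecker_one[OF assms] by (simp add: stride_zero)
qed

section \<open>Evaluation in the algebraic closure and reversal of polynomials\<close>

lemma (in comm_ring_hom) mat_hom_kronecker:
  "map_mat hom (A \<otimes>\<^sub>K B) = map_mat hom A \<otimes>\<^sub>K map_mat hom B"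
proof (rule eq_matI)
  \<comment> \<open>An index below \<open>m * n\<close> exists only for positive
    \<open>n\<close>.\<close>
  have mod: "i mod n < n" if "i < m * n" for i m n :: nat
    using that by (cases n) auto
  fix i j assume "i < dim_row (map_mat hom A \<otimes>\<^sub>K map_mat hom B)"
    "j < dim_col (map_mat hom A \<otimes>\<^sub>K map_mat hom B)"
  then show "map_mat hom (A \<otimes>\<^sub>K B) $$ (i, j) = (map_mat hom A \<otimes>\<^sub>K map_mat hom B) $$ (i, j)"
    by (simp add: kronecker_def hom_mult less_mult_imp_div_less mod)
qed (simp_all add: kronecker_def)

text \<open>Coefficient embedding followed by evaluation is a composition of ring homomorphisms;
  this makes the homomorphism laws for matrices available for \<open>eval_mat_poly\<close>.\<close>

lemma map_poly_to_ac_eval_hom: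
  "comm_ring_hom (\<lambda>p :: 'a :: field poly. poly (map_poly to_ac p) c)"
proof -
  interpret to_ac: comm_ring_hom "to_ac :: 'a \<Rightarrow> _" by unfold_locales auto
  interpret mp: map_poly_comm_ring_hom "to_ac :: 'a \<Rightarrow> _" ..
  show ?thesis by unfold_locales (auto simp: mp.hom_add mp.hom_mult)
qed

lemma coeff_poly_rev: "coeff (poly_rev g p) k = (if k \<le> g then coeff p (g - k) else 0)"
proof -
  \<comment> \<open>The inner test \<open>k \<le> g\<close> matters: for larger \<open>k\<close> the
    truncated difference \<open>g - k\<close> is 0, which lies in the range and would wrongly pick
    the constant coefficient.\<close>
  have "coeff (poly_rev g p) k = (\<Sum>j\<le>g. if j = g - k then if k \<le> g then coeff p j else 0 else 0)"
    unfolding poly_rev_def coeff_sum by (rule sum.cong) auto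
  then show ?thesis by simp
qed

lemma degree_poly_rev: "degree (poly_rev g p) \<le> g"
  by (rule degree_le) (simp add: coeff_poly_rev)

lemma poly_rev_poly_rev: "degree p \<le> g \<Longrightarrow> poly_rev g (poly_rev g p) = p"
  by (rule poly_eqI) (auto simp: coeff_poly_rev coeff_eq_0)

lemma poly_map_poly_to_ac_poly_rev:
  fixes p :: "'a :: field poly"
  assumes "degree p \<le> g" "c \<noteq> 0"
  shows "poly (map_poly to_ac (poly_rev g p)) c = c ^ g * poly (map_poly to_ac p) (inverse c)"
proof -
  \<comment> \<open>Summing up to \<open>g\<close> instead of the degree gives \<open>p\<close> and
    its reversal a common range, on which \<open>k\<close> and \<open>g - k\<close> can be
    exchanged.\<close>
  have ev: "poly (map_poly to_ac q) x = (\<Sum>k\<le>g. to_ac (coeff q k) * x ^ k)"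
    if "degree q \<le> g" for q :: "'a poly" and x
  proof -
    have "degree (map_poly to_ac q) \<le> g" using degree_map_poly_le[of to_ac q] that by simp
    then show ?thesis unfolding poly_altdef
      by (intro sum.mono_neutral_cong_left) (auto simp: coeff_map_poly intro: le_degree)
  qed
  have "poly (map_poly to_ac (poly_rev g p)) c = (\<Sum>k\<le>g. to_ac (coeff p (g - k)) * c ^ k)"
    by (simp add: ev degree_poly_rev coeff_poly_rev)
  also have "\<dots> = (\<Sum>k\<le>g. to_ac (coeff p k) * c ^ (g - k))"
    by (rule sum.reindex_bij_witness[of _ "\<lambda>k. g - k" "\<lambda>k. g - k"]) auto
  also have "\<dots> = (\<Sum>k\<le>g. c ^ g * (to_ac (coeff p k) * inverse c ^ k))"
    using assms(2) by (intro sum.cong) (simp_all add: power_diff power_inverse divide_inverse)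
  finally show ?thesis using assms by (simp add: ev sum_distrib_left)
qed

section \<open>Elementary matrix-vector identities\<close>

lemma smult_mult_mat_vec:
  fixes A :: "'a :: comm_semiring_0 mat"
  assumes "A \<in> carrier_mat r c" "v \<in> carrier_vec c"
  shows "(k \<cdot>\<^sub>m A) *\<^sub>v v = k \<cdot>\<^sub>v (A *\<^sub>v v)"
  using assms by (intro eq_vecI) (auto simp: scalar_prod_def sum_distrib_left mult.assoc)

lemma mult_mat_zero_vec:
  fixes A :: "'a :: semiring_0 mat"
  shows "A \<in> carrier_mat r c \<Longrightarrow> A *\<^sub>v 0\<^sub>v c = 0\<^sub>v r"
  by (intro eq_vecI) (auto simp: scalar_prod_def)

lemma zero_mult_mat_vec:
  fixes v :: "'a :: semiring_0 vec"
  shows "v \<in> carrier_vec c \<Longrightarrow> 0\<^sub>m r c *\<^sub>v v = 0\<^sub>v r"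
  by (intro eq_vecI) (auto simp: scalar_prod_def)

lemma zero_append_vec: "0\<^sub>v m @\<^sub>v 0\<^sub>v n = 0\<^sub>v (m + n)"
  by (intro eq_vecI) auto

section \<open>Kernels of \<open>L_hat\<close> and its transpose at a scalar\<close>

text \<open>The value of \<open>L_hat k\<close> at the point \<open>c\<close>, given over any
  commutative ring so that the kernel computations involve scalars only; \<open>eval_L_hat\<close>
  links the two.\<close>

definition L_hat_at :: "nat \<Rightarrow> 'a \<Rightarrow> 'a :: comm_ring_1 mat" where
  "L_hat_at k c = mat (k - 1) (k + 1)
     (\<lambda>(i, j). if j = i + 1 then -1 else if j = i + 2 then c else 0)"

definition Lambda_hat_at :: "nat \<Rightarrow> 'a \<Rightarrow> 'a :: comm_ring_1 mat" where
  "Lambda_hat_at k c = mat (k + 1) 2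
     (\<lambda>(i, j). if j = 0 then (if i = 0 then 1 else 0) else (if i = 0 then 0 else c ^ (k - i)))"

lemma L_hat_at_carrier [simp]: "L_hat_at k c \<in> carrier_mat (k - 1) (k + 1)"
  by (simp add: L_hat_at_def)

lemma Lambda_hat_at_carrier [simp]: "Lambda_hat_at k c \<in> carrier_mat (k + 1) 2"
  by (simp add: Lambda_hat_at_def)

lemma index_L_hat_at_mult_vec:
  assumes "u \<in> carrier_vec (k + 1)" "i < k - 1"
  shows "(L_hat_at k c *\<^sub>v u) $ i = c * u $ (i + 2) - u $ (i + 1)"
proof -
  have "(L_hat_at k c *\<^sub>v u) $ i =
      (\<Sum>j<k + 1. (if j = i + 1 then - u $ j else 0) + (if j = i + 2 then c * u $ j else 0))"
    using assms by (auto simp: L_hat_at_def scalar_prod_def atLeast0LessThan intro!: sum.cong)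
  also have "\<dots> = c * u $ (i + 2) - u $ (i + 1)"
    unfolding sum.distrib using assms(2) by auto
  finally show ?thesis .
qed

text \<open>The shift to position \<open>i + 1\<close> skips entry 0 of the product, which comes
  from the zero first column of \<open>L_hat_at\<close>.\<close>

lemma index_transpose_L_hat_at_mult_vec:
  assumes "y \<in> carrier_vec (k - 1)" "i < k - 1"
  shows "((L_hat_at k c)\<^sup>T *\<^sub>v y) $ (i + 1) = (if i = 0 then 0 else c * y $ (i - 1)) - y $ i"
proof -
  \<comment> \<open>For \<open>i = 0\<close> the truncated \<open>i - 1\<close> is again 0, so the
    inner test has to suppress a spurious second term.\<close>
  have "((L_hat_at k c)\<^sup>T *\<^sub>v y) $ (i + 1) =
      (\<Sum>j<k - 1. (if j = i then - y $ j else 0) +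
        (if j = i - 1 then if i = 0 then 0 else c * y $ j else 0))"
    using assms by (auto simp: L_hat_at_def scalar_prod_def atLeast0LessThan intro!: sum.cong)
  also have "\<dots> = (if i = 0 then 0 else c * y $ (i - 1)) - y $ i"
    unfolding sum.distrib using assms(2) by (cases i) auto
  finally show ?thesis .
qed

lemma index_Lambda_hat_at_mult_vec:
  assumes "w \<in> carrier_vec 2" "i < k + 1"
  shows "(Lambda_hat_at k c *\<^sub>v w) $ i = (if i = 0 then w $ 0 else c ^ (k - i) * w $ 1)"
  using assms by (auto simp: Lambda_hat_at_def scalar_prod_def numeral_2_eq_2)

text \<open>The first column of \<open>Lambda_hat_at\<close> meets the zero column of
  \<open>L_hat_at\<close>; the second consists of powers of \<open>c\<close> with each entry
  \<open>c\<close> times the next, which is what the rows of \<open>L_hat_at\<close> test.\<close>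

lemma L_hat_at_mult_Lambda_hat_at: "L_hat_at k c * Lambda_hat_at k c = 0\<^sub>m (k - 1) 2"
proof (rule eq_matI)
  fix i j assume "i < dim_row (0\<^sub>m (k - 1) 2 :: 'a mat)" "j < dim_col (0\<^sub>m (k - 1) 2 :: 'a mat)"
  then have i: "i < k - 1" and j: "j < 2" by auto
  have "Suc (k - (i + 2)) = k - (i + 1)" using i by simp
  then have p: "c * c ^ (k - (i + 2)) = c ^ (k - (i + 1))" by (metis power_Suc)
  have "(L_hat_at k c * Lambda_hat_at k c) $$ (i, j) =
      (L_hat_at k c *\<^sub>v col (Lambda_hat_at k c) j) $ i"
    using i j by (simp add: L_hat_at_def Lambda_hat_at_def)
  also have "\<dots> = 0"
    using i j p by (subst index_L_hat_at_mult_vec) (auto simp: Lambda_hat_at_def)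
  finally show "(L_hat_at k c * Lambda_hat_at k c) $$ (i, j) = 0\<^sub>m (k - 1) 2 $$ (i, j)"
    using i j by simp
qed (simp_all add: L_hat_at_def Lambda_hat_at_def)

text \<open>A null vector satisfies u(i+1) = c u(i+2), so its last entry determines all others by
  descent, except entry 0, which stays free.\<close>

lemma L_hat_at_kernel:
  assumes u: "u \<in> carrier_vec (k + 1)" and 0: "L_hat_at k c *\<^sub>v u = 0\<^sub>v (k - 1)"
  shows "u = Lambda_hat_at k c *\<^sub>v vec 2 (\<lambda>l. if l = 0 then u $ 0 else u $ k)"
proof (rule eq_vecI)
  \<comment> \<open>\<open>m\<close> is the distance from the last entry; \<open>m < k\<close> keeps
    the position away from the free entry 0.\<close>
  have pow: "u $ (k - m) = c ^ m * u $ k" if "m < k" for m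
    using that
  proof (induction m)
    case (Suc m)
    \<comment> \<open>This row of \<open>L_hat_at\<close> relates the neighbouring positions
      \<open>k - m\<close> and \<open>k - Suc m\<close>.\<close>
    define i where "i = k - m - 2"
    have i: "i < k - 1" "i + 2 = k - m" "i + 1 = k - Suc m" using Suc.prems by (auto simp: i_def)
    have "(L_hat_at k c *\<^sub>v u) $ i = 0" unfolding 0 using i(1) by simp
    then have "c * u $ (k - m) - u $ (k - Suc m) = 0"
      unfolding index_L_hat_at_mult_vec[OF u i(1)] i(2,3) .
    then show ?case using Suc by (simp add: mult.assoc)
  qed simp
  fix i assume "i < dim_vec (Lambda_hat_at k c *\<^sub>v vec 2 (\<lambda>l. if l = 0 then u $ 0 else u $ k))"
  then have i: "i < k + 1" by (simp add: Lambda_hat_at_def)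
  have "u $ i = c ^ (k - i) * u $ k" if "i \<noteq> 0" using pow[of "k - i"] that i by simp
  then show "u $ i = (Lambda_hat_at k c *\<^sub>v vec 2 (\<lambda>l. if l = 0 then u $ 0 else u $ k)) $ i"
    using i by (simp add: index_Lambda_hat_at_mult_vec)
qed (use u in \<open>simp add: Lambda_hat_at_def\<close>)

text \<open>Entries 1 to \<open>k - 1\<close> of the product form a lower triangular system with
  diagonal -1, so forward substitution works for every \<open>c\<close>, including 0.\<close>

lemma transpose_L_hat_at_injective:
  assumes y: "y \<in> carrier_vec (k - 1)" and 0: "(L_hat_at k c)\<^sup>T *\<^sub>v y = 0\<^sub>v (k + 1)"
  shows "y = 0\<^sub>v (k - 1)"
proof (rule eq_vecI)
  have "y $ i = 0" if "i < k - 1" for i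
    using that
  proof (induction i)
    case 0
    then show ?case
      using index_transpose_L_hat_at_mult_vec[OF y, of 0 c] assms(2) by simp
  next
    case (Suc i)
    then show ?case
      using index_transpose_L_hat_at_mult_vec[OF y Suc.prems, of c] assms(2) by simp
  qed
  then show "\<And>i. i < dim_vec (0\<^sub>v (k - 1)) \<Longrightarrow> y $ i = 0\<^sub>v (k - 1) $ i" by simp
qed (use y in simp)

section \<open>Null vectors of the block Kronecker matrix at a point\<close>

text \<open>The scalar core of both parts: \<open>K\<close> and \<open>R\<close> play the values at
  \<open>c\<close> of the upper left pencil and of the reversed polynomial. Since \<open>c\<close>
  may be 0, the infinite eigenvalue is covered as well.\<close>

lemma block_pencil_kernel:
  fixes K P0 R :: "'a :: field mat"
  assumes t: "t \<ge> 1"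
    and K: "K \<in> carrier_mat ((t + 1) * n) ((t + 1) * n)"
    and P0: "P0 \<in> carrier_mat n n" and R: "R \<in> carrier_mat n n"
    and det: "det P0 \<noteq> 0" and s: "s \<noteq> 0"
    and dual: "((Lambda_hat_at t c)\<^sup>T \<otimes>\<^sub>K 1\<^sub>m n) * K * (Lambda_hat_at t c \<otimes>\<^sub>K 1\<^sub>m n) =
      four_block_mat (- P0) (c ^ t \<cdot>\<^sub>m P0) (c ^ t \<cdot>\<^sub>m P0) (R - c ^ (2 * t) \<cdot>\<^sub>m P0)"
    and z: "z \<in> carrier_vec ((t + 1) * n + (t - 1) * n)"
      "z \<noteq> 0\<^sub>v ((t + 1) * n + (t - 1) * n)"
    and ker: "four_block_mat K ((L_hat_at t c)\<^sup>T \<otimes>\<^sub>K 1\<^sub>m n) ((s \<cdot>\<^sub>m L_hat_at t c) \<otimes>\<^sub>K 1\<^sub>m n)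
        (0\<^sub>m ((t - 1) * n) ((t - 1) * n)) *\<^sub>v z = 0\<^sub>v ((t + 1) * n + (t - 1) * n)"
  shows "R *\<^sub>v vec_block n (t + 1) z = 0\<^sub>v n" "vec_block n (t + 1) z \<noteq> 0\<^sub>v n"
proof -
  \<comment> \<open>Block counts of the upper and lower part; fresh names keep products such as
    \<open>(t + 1) * n\<close> from being expanded.\<close>
  obtain N M where N: "N = t + 1" and M: "M = t - 1" by blast
  note K = K[folded N] and z = z[folded N M] and ker = ker[folded N M]
  define x where "x = vec_first z (N * n)"
  define y where "y = vec_last z (M * n)"
  \<comment> \<open>The first and last blocks of \<open>x\<close>: its coordinates with respect to
    the two block columns of \<open>H \<otimes>\<^sub>K 1\<^sub>m n\<close>.\<close>
  define w1 where "w1 = vec n (\<lambda>k. x $ k)"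
  define w2 where "w2 = vec n (\<lambda>k. x $ (t * n + k))"
  define G where "G = L_hat_at t c"
  define H where "H = Lambda_hat_at t c"
  have G: "G \<in> carrier_mat M N" and H: "H \<in> carrier_mat N 2"
    unfolding G_def H_def N M by (rule L_hat_at_carrier Lambda_hat_at_carrier)+
  have GT: "G\<^sup>T \<in> carrier_mat N M" and HT: "H\<^sup>T \<in> carrier_mat 2 N"
    using G H by simp_all
  have G1: "(s \<cdot>\<^sub>m G) \<otimes>\<^sub>K 1\<^sub>m n \<in> carrier_mat (M * n) (N * n)"
    and GT1: "G\<^sup>T \<otimes>\<^sub>K 1\<^sub>m n \<in> carrier_mat (N * n) (M * n)"
    and H1: "H \<otimes>\<^sub>K 1\<^sub>m n \<in> carrier_mat (N * n) (2 * n)"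
    and HT1: "H\<^sup>T \<otimes>\<^sub>K 1\<^sub>m n \<in> carrier_mat (2 * n) (N * n)"
    using G GT H HT by (auto intro!: kronecker_carrier)
  have x: "x \<in> carrier_vec (N * n)" and y: "y \<in> carrier_vec (M * n)"
    and w1: "w1 \<in> carrier_vec n" and w2: "w2 \<in> carrier_vec n"
    by (simp_all add: x_def y_def w1_def w2_def)
  have zxy: "z = x @\<^sub>v y" using z(1) by (simp add: x_def y_def)
  have w2_block: "w2 = vec_block n (t + 1) z"
  proof (rule eq_vecI)
    fix k assume "k < dim_vec (vec_block n (t + 1) z)"
    then have k: "k < n" by (simp add: vec_block_def)
    have "t * n + k < N * n" by (rule nat_block_less[OF _ k]) (simp add: N)
    then show "w2 $ k = vec_block n (t + 1) z $ k"
      using k by (simp add: w2_def vec_block_def x_def vec_first_def)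
  qed (simp add: w2_def vec_block_def)

  \<comment> \<open>The kernel equation is separated into its two block rows.\<close>
  have "(K *\<^sub>v x + (G\<^sup>T \<otimes>\<^sub>K 1\<^sub>m n) *\<^sub>v y) @\<^sub>v (((s \<cdot>\<^sub>m G) \<otimes>\<^sub>K 1\<^sub>m n) *\<^sub>v x + 0\<^sub>v (M * n)) =
      0\<^sub>v (N * n) @\<^sub>v 0\<^sub>v (M * n)"
    using ker four_block_mat_mult_vec[OF K GT1 G1 zero_carrier_mat x y]
    by (simp add: zxy G_def zero_append_vec zero_mult_mat_vec[OF y])
  moreover have "K *\<^sub>v x + (G\<^sup>T \<otimes>\<^sub>K 1\<^sub>m n) *\<^sub>v y \<in> carrier_vec (N * n)"
    by (intro add_carrier_vec mult_mat_vec_carrier[OF K x] mult_mat_vec_carrier[OF GT1 y])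
  ultimately have top: "K *\<^sub>v x + (G\<^sup>T \<otimes>\<^sub>K 1\<^sub>m n) *\<^sub>v y = 0\<^sub>v (N * n)"
    and "((s \<cdot>\<^sub>m G) \<otimes>\<^sub>K 1\<^sub>m n) *\<^sub>v x + 0\<^sub>v (M * n) = 0\<^sub>v (M * n)"
    by (simp_all only: append_vec_eq[OF _ zero_carrier_vec])
  then have sGx: "((s \<cdot>\<^sub>m G) \<otimes>\<^sub>K 1\<^sub>m n) *\<^sub>v x = 0\<^sub>v (M * n)"
    using mult_mat_vec_carrier[OF G1 x] by simp
  have Gx: "G *\<^sub>v stride n k x = 0\<^sub>v M" if k: "k < n" for k
  proof -
    have sG: "s \<cdot>\<^sub>m G \<in> carrier_mat M N" using G by simp
    have "(s \<cdot>\<^sub>m G) *\<^sub>v stride n k x = 0\<^sub>v M"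
      using kronecker_one_mult_vec_eq_0_iff[OF sG x] sGx k by blast
    then have "s \<cdot>\<^sub>v (G *\<^sub>v stride n k x) = 0\<^sub>v M"
      by (simp only: smult_mult_mat_vec[OF G stride_carrier[OF x k]])
    then have "inverse s \<cdot>\<^sub>v (s \<cdot>\<^sub>v (G *\<^sub>v stride n k x)) = 0\<^sub>v M"
      by (simp only:) (intro eq_vecI, auto)
    then show ?thesis using s by (simp add: smult_smult_assoc)
  qed
  have w: "w1 @\<^sub>v w2 \<in> carrier_vec (2 * n)" using w1 w2 by (simp add: mult_2)
  have stride_w: "stride n k (w1 @\<^sub>v w2) = vec 2 (\<lambda>l. if l = 0 then stride n k x $ 0 else stride n k x $ t)"
    if k: "k < n" for k
  proof (rule eq_vecI)
    fix l assume "l < dim_vec (vec 2 (\<lambda>l. if l = 0 then stride n k x $ 0 else stride n k x $ t))"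
    then have l: "l < 2" by simp
    have x0: "stride n k x $ 0 = x $ k" using index_stride[OF x _ k, of 0] by (simp add: N)
    have xt: "stride n k x $ t = x $ (t * n + k)" using index_stride[OF x _ k, of t] by (simp add: N)
    have "l = 0 \<or> l = 1" using l by auto
    then show "stride n k (w1 @\<^sub>v w2) $ l =
        vec 2 (\<lambda>l. if l = 0 then stride n k x $ 0 else stride n k x $ t) $ l"
      using k w1 w2 x0 xt by (auto simp: index_stride[OF w l k]) (auto simp: w1_def w2_def)
  qed (use stride_carrier[OF w k] in simp)
  \<comment> \<open>Each stride of \<open>x\<close> is a null vector of \<open>G\<close>, hence
    given by \<open>L_hat_at_kernel\<close>; the strides are then reassembled.\<close>
  have xw: "x = (H \<otimes>\<^sub>K 1\<^sub>m n) *\<^sub>v (w1 @\<^sub>v w2)"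
  proof (rule eq_vec_if_stride_eq[OF x])
    show "(H \<otimes>\<^sub>K 1\<^sub>m n) *\<^sub>v (w1 @\<^sub>v w2) \<in> carrier_vec (N * n)"
      using H1 w by simp
    fix k assume k: "k < n"
    show "stride n k x = stride n k ((H \<otimes>\<^sub>K 1\<^sub>m n) *\<^sub>v (w1 @\<^sub>v w2))"
      unfolding stride_kronecker_one[OF H w k] stride_w[OF k]
      by (rule L_hat_at_kernel[of _ t c, folded G_def H_def N M, OF stride_carrier[OF x k] Gx[OF k]])
  qed
  \<comment> \<open>Transposing \<open>G * H = 0\<close> shows that multiplying the upper block row
    by \<open>H\<^sup>T \<otimes>\<^sub>K 1\<^sub>m n\<close> eliminates \<open>y\<close>.\<close>
  have "H\<^sup>T * G\<^sup>T = 0\<^sub>m 2 M"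
    using transpose_mult[OF G H] unfolding G_def H_def L_hat_at_mult_Lambda_hat_at M by simp
  then have "H\<^sup>T *\<^sub>v stride n k ((G\<^sup>T \<otimes>\<^sub>K 1\<^sub>m n) *\<^sub>v y) = 0\<^sub>v 2" if k: "k < n" for k
    using assoc_mult_mat_vec[OF HT GT stride_carrier[OF y k]] zero_mult_mat_vec[OF stride_carrier[OF y k]]
    by (simp only: stride_kronecker_one[OF GT y k])
  then have "(H\<^sup>T \<otimes>\<^sub>K 1\<^sub>m n) *\<^sub>v ((G\<^sup>T \<otimes>\<^sub>K 1\<^sub>m n) *\<^sub>v y) = 0\<^sub>v (2 * n)"
    using kronecker_one_mult_vec_eq_0_iff[OF HT mult_mat_vec_carrier[OF GT1 y]] by blast
  moreover have "(H\<^sup>T \<otimes>\<^sub>K 1\<^sub>m n) *\<^sub>v (K *\<^sub>v x + (G\<^sup>T \<otimes>\<^sub>K 1\<^sub>m n) *\<^sub>v y) = 0\<^sub>v (2 * n)"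
    unfolding top by (rule mult_mat_zero_vec[OF HT1])
  ultimately have "(H\<^sup>T \<otimes>\<^sub>K 1\<^sub>m n) *\<^sub>v (K *\<^sub>v x) = 0\<^sub>v (2 * n)"
    using mult_add_distrib_mat_vec[OF HT1 mult_mat_vec_carrier[OF K x] mult_mat_vec_carrier[OF GT1 y]]
      mult_mat_vec_carrier[OF HT1 mult_mat_vec_carrier[OF K x]] by simp
  then have "((H\<^sup>T \<otimes>\<^sub>K 1\<^sub>m n) * K * (H \<otimes>\<^sub>K 1\<^sub>m n)) *\<^sub>v (w1 @\<^sub>v w2) = 0\<^sub>v (2 * n)"
    using assoc_mult_mat_vec[OF mult_carrier_mat[OF HT1 K] H1 w]
      assoc_mult_mat_vec[OF HT1 K x] xw by simp
  \<comment> \<open>The assumption \<open>dual\<close> turns the compressed equation into a 2 by 2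
    block system for \<open>w1\<close> and \<open>w2\<close>.\<close>
  then have "four_block_mat (- P0) (c ^ t \<cdot>\<^sub>m P0) (c ^ t \<cdot>\<^sub>m P0) (R - c ^ (2 * t) \<cdot>\<^sub>m P0)
      *\<^sub>v (w1 @\<^sub>v w2) = 0\<^sub>v n @\<^sub>v 0\<^sub>v n"
    using dual by (simp add: H_def zero_append_vec mult_2)
  moreover have mP0: "- P0 \<in> carrier_mat n n" and cP0: "c ^ m \<cdot>\<^sub>m P0 \<in> carrier_mat n n"
    and RP0: "R - c ^ (2 * t) \<cdot>\<^sub>m P0 \<in> carrier_mat n n" for m
    using P0 R by auto
  ultimately have "(- P0 *\<^sub>v w1 + (c ^ t \<cdot>\<^sub>m P0) *\<^sub>v w2) @\<^sub>v
      ((c ^ t \<cdot>\<^sub>m P0) *\<^sub>v w1 + (R - c ^ (2 * t) \<cdot>\<^sub>m P0) *\<^sub>v w2) = 0\<^sub>v n @\<^sub>v 0\<^sub>v n"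
    using four_block_mat_mult_vec[OF mP0 cP0 cP0 RP0 w1 w2] by simp
  moreover have "- P0 *\<^sub>v w1 + (c ^ t \<cdot>\<^sub>m P0) *\<^sub>v w2 \<in> carrier_vec n"
    by (intro add_carrier_vec mult_mat_vec_carrier[OF mP0 w1] mult_mat_vec_carrier[OF cP0 w2])
  ultimately have "- P0 *\<^sub>v w1 + (c ^ t \<cdot>\<^sub>m P0) *\<^sub>v w2 = 0\<^sub>v n"
    and "(c ^ t \<cdot>\<^sub>m P0) *\<^sub>v w1 + (R - c ^ (2 * t) \<cdot>\<^sub>m P0) *\<^sub>v w2 = 0\<^sub>v n"
    by (simp_all only: append_vec_eq[OF _ zero_carrier_vec])
  then have eq1: "- (P0 *\<^sub>v w1) + c ^ t \<cdot>\<^sub>v (P0 *\<^sub>v w2) = 0\<^sub>v n"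
    and eq2: "c ^ t \<cdot>\<^sub>v (P0 *\<^sub>v w1) + (R *\<^sub>v w2 - c ^ (2 * t) \<cdot>\<^sub>v (P0 *\<^sub>v w2)) = 0\<^sub>v n"
    using P0 w1 w2
    by (simp_all add: smult_mult_mat_vec[OF P0] minus_mult_distrib_mat_vec[OF R cP0])
  have row1: "(P0 *\<^sub>v w1) $ i = c ^ t * (P0 *\<^sub>v w2) $ i" if "i < n" for i
    using arg_cong[OF eq1, of "\<lambda>v. vec_index v i"] that P0 w1 w2 by (simp add: add_eq_0_iff)
  have row2: "c ^ t * (P0 *\<^sub>v w1) $ i + ((R *\<^sub>v w2) $ i - c ^ (2 * t) * (P0 *\<^sub>v w2) $ i) = 0"
    if "i < n" for i
    using arg_cong[OF eq2, of "\<lambda>v. vec_index v i"] that P0 R w1 w2 by simp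
  have "(R *\<^sub>v w2) $ i = 0" if "i < n" for i
  proof -
    \<comment> \<open>Substituting the first row into the second makes the two terms with
      \<open>P0\<close> cancel.\<close>
    have "c ^ (2 * t) = c ^ t * c ^ t" by (simp add: mult_2 power_add)
    then show ?thesis using row2[OF that] unfolding row1[OF that] by (simp add: mult.assoc)
  qed
  then show "R *\<^sub>v vec_block n (t + 1) z = 0\<^sub>v n"
    unfolding w2_block[symmetric] using R by (intro eq_vecI) auto
  show "vec_block n (t + 1) z \<noteq> 0\<^sub>v n"
  proof
    \<comment> \<open>Zeros propagate: from \<open>w2\<close> to \<open>w1\<close> by nonsingularity
      of \<open>P0\<close>, then to \<open>x\<close>, and to \<open>y\<close> by injectivity of
      \<open>G\<^sup>T\<close>, contradicting that \<open>z\<close> is nonzero.\<close>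
    assume "vec_block n (t + 1) z = 0\<^sub>v n"
    then have w20: "w2 = 0\<^sub>v n" using w2_block by simp
    have Pw2: "P0 *\<^sub>v w2 = 0\<^sub>v n" using mult_mat_zero_vec[OF P0] by (simp only: w20)
    have Pw1: "P0 *\<^sub>v w1 = 0\<^sub>v n"
      using row1 Pw2 P0 by (intro eq_vecI) auto
    have w10: "w1 = 0\<^sub>v n"
    proof (rule ccontr)
      assume "w1 \<noteq> 0\<^sub>v n"
      then have "det P0 = 0"
        unfolding det_0_iff_vec_prod_zero_field[OF P0] using w1 Pw1 by (intro exI conjI)
      then show False using det by contradiction
    qed
    have x0: "x = 0\<^sub>v (N * n)"
      using xw mult_mat_zero_vec[OF H1] by (simp add: w10 w20 zero_append_vec mult_2)
    have "(G\<^sup>T \<otimes>\<^sub>K 1\<^sub>m n) *\<^sub>v y = 0\<^sub>v (N * n)"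
      using top mult_mat_zero_vec[OF K] mult_mat_vec_carrier[OF GT1 y] by (simp add: x0)
    then have GTy: "G\<^sup>T *\<^sub>v stride n k y = 0\<^sub>v N" if "k < n" for k
      by (rule kronecker_one_mult_vec_eq_0_iff[OF GT y, THEN iffD1, rule_format, OF _ that])
    have y0: "y = 0\<^sub>v (M * n)"
    proof (rule eq_vec_if_stride_eq[OF y zero_carrier_vec])
      fix k assume k: "k < n"
      have "stride n k y = 0\<^sub>v M"
        by (rule transpose_L_hat_at_injective[of _ t c, folded G_def N M,
              OF stride_carrier[OF y k] GTy[OF k]])
      then show "stride n k y = stride n k (0\<^sub>v (M * n))" by (simp only: stride_zero[OF k])
    qed
    show False using z(2) by (simp add: zxy x0 y0 zero_append_vec)
  qed
qed

section \<open>Evaluation, degree and reversal of matrix polynomials\<close>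

lemma (in comm_ring_hom) smult_mat_hom: "map_mat hom (k \<cdot>\<^sub>m A) = hom k \<cdot>\<^sub>m map_mat hom A"
  by (rule eq_matI) (auto simp: hom_mult)

lemma eval_mat_poly_carrier: "M \<in> carrier_mat r c \<Longrightarrow> eval_mat_poly M x \<in> carrier_mat r c"
  by (simp add: eval_mat_poly_def)

lemma eval_L_hat: "eval_mat_poly (L_hat k) c = L_hat_at k c"
proof -
  interpret ev: comm_ring_hom "\<lambda>p :: 'a poly. poly (map_poly to_ac p) c"
    by (rule map_poly_to_ac_eval_hom)
  show ?thesis
    by (rule eq_matI) (auto simp: eval_mat_poly_def L_hat_def L_hat_at_def ev.hom_uminus map_poly_pCons)
qed

lemma eval_Lambda_hat: "eval_mat_poly (Lambda_hat k) c = Lambda_hat_at k c"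
  by (rule eq_matI) (auto simp: eval_mat_poly_def Lambda_hat_def Lambda_hat_T_def Lambda_hat_at_def
      map_poly_monom poly_monom)

lemma poly_map_poly_to_ac_const: "poly (map_poly to_ac [:a:]) c = to_ac a"
  by (cases "a = 0") (simp_all add: map_poly_pCons)

lemma eval_const_mat: "eval_mat_poly (const_mat A) c = map_mat to_ac A"
  by (rule eq_matI) (auto simp: eval_mat_poly_def const_mat_def poly_map_poly_to_ac_const)

lemma degree_le_mat_poly_degree:
  assumes "M \<in> carrier_mat r c" "i < r" "j < c"
  shows "degree (M $$ (i, j)) \<le> mat_poly_degree M"
proof -
  have "finite (elements_mat M)" by (simp add: elements_mat_def)
  then show ?thesis
    using elements_matI[OF assms refl] unfolding mat_poly_degree_def by (intro Max_ge) auto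
qed

lemma mat_poly_degree_le:
  assumes "M \<in> carrier_mat r c" "\<And>i j. i < r \<Longrightarrow> j < c \<Longrightarrow> degree (M $$ (i, j)) \<le> g"
  shows "mat_poly_degree M \<le> g"
proof -
  have "finite (elements_mat M)" by (simp add: elements_mat_def)
  then show ?thesis
    unfolding mat_poly_degree_def using assms by (intro Max.boundedI) auto
qed

lemma pencil_carrier: "X \<in> carrier_mat r c \<Longrightarrow> Y \<in> carrier_mat r c \<Longrightarrow> pencil X Y \<in> carrier_mat r c"
  by (simp add: pencil_def const_mat_def)

lemma index_pencil:
  "X \<in> carrier_mat r c \<Longrightarrow> Y \<in> carrier_mat r c \<Longrightarrow> i < r \<Longrightarrow> j < c \<Longrightarrow>
    pencil X Y $$ (i, j) = [:Y $$ (i, j), X $$ (i, j):]"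
  by (simp add: pencil_def const_mat_def)

lemma mat_poly_rev_pencil:
  assumes "X \<in> carrier_mat r c" "Y \<in> carrier_mat r c"
  shows "mat_poly_rev 1 (pencil X Y) = pencil Y X"
proof (rule eq_matI)
  have rev: "poly_rev 1 [:a, b:] = [:b, a:]" for a b :: 'a
    by (rule poly_eqI) (auto simp: coeff_poly_rev coeff_pCons split: nat.splits)
  fix i j assume "i < dim_row (pencil Y X)" "j < dim_col (pencil Y X)"
  then have "i < r" "j < c" using pencil_carrier[OF assms(2,1)] by auto
  then show "mat_poly_rev 1 (pencil X Y) $$ (i, j) = pencil Y X $$ (i, j)"
    using assms pencil_carrier[OF assms] index_pencil[OF assms] index_pencil[OF assms(2,1)]
    by (simp add: mat_poly_rev_def rev[unfolded One_nat_def])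
qed (use pencil_carrier[OF assms] pencil_carrier[OF assms(2,1)] in \<open>simp_all add: mat_poly_rev_def\<close>)

lemma mat_poly_rev_mat_poly_rev:
  assumes "M \<in> carrier_mat r c" "\<And>i j. i < r \<Longrightarrow> j < c \<Longrightarrow> degree (M $$ (i, j)) \<le> g"
  shows "mat_poly_rev g (mat_poly_rev g M) = M"
  using assms by (intro eq_matI) (auto simp: mat_poly_rev_def poly_rev_poly_rev)

text \<open>A nonzero constant coefficient becomes the coefficient of index \<open>g\<close>, so the
  reversal attains the full degree \<open>g\<close>.\<close>

lemma mat_poly_degree_mat_poly_rev:
  assumes M: "M \<in> carrier_mat r c" and ne: "coeff_mat M 0 \<noteq> 0\<^sub>m r c"
  shows "mat_poly_degree (mat_poly_rev g M) = g"
proof (rule antisym)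
  have R: "mat_poly_rev g M \<in> carrier_mat r c" using M by (simp add: mat_poly_rev_def)
  show "mat_poly_degree (mat_poly_rev g M) \<le> g"
    using M by (intro mat_poly_degree_le[OF R]) (simp add: mat_poly_rev_def degree_poly_rev)
  obtain i j where ij: "i < r" "j < c" "coeff (M $$ (i, j)) 0 \<noteq> 0"
    using ne M by (auto simp: coeff_mat_def mat_eq_iff)
  then have "g \<le> degree (mat_poly_rev g M $$ (i, j))"
    using M by (intro le_degree) (simp add: mat_poly_rev_def coeff_poly_rev)
  also have "\<dots> \<le> mat_poly_degree (mat_poly_rev g M)"
    by (rule degree_le_mat_poly_degree[OF R ij(1,2)])
  finally show "g \<le> mat_poly_degree (mat_poly_rev g M)" .
qed

section \<open>Linearizations and eigenvectors under reversal\<close>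

lemma is_strong_linearization_carrier:
  assumes "is_strong_linearization L P"
  obtains X Y m where "L = pencil X Y"
    "X \<in> carrier_mat (m + dim_row P) (m + dim_col P)" "Y \<in> carrier_mat (m + dim_row P) (m + dim_col P)"
    "is_linearization X Y P" "is_linearization Y X (mat_poly_rev (mat_poly_degree P) P)"
  using assms unfolding is_strong_linearization_def is_linearization_def Let_def by blast

text \<open>Reversal exchanges the two pencil coefficients and hence the two halves of the
  definition. By \<open>ne\<close> the reversed polynomial keeps the degree of \<open>P\<close>, so
  reversing it with its own degree returns \<open>P\<close>.\<close>

lemma is_strong_linearization_rev:
  assumes P: "P \<in> carrier_mat r c" and ne: "coeff_mat P 0 \<noteq> 0\<^sub>m r c"
    and L: "is_strong_linearization L (mat_poly_rev (mat_poly_degree P) P)"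
  shows "is_strong_linearization (mat_poly_rev 1 L) P"
proof -
  let ?Q = "mat_poly_rev (mat_poly_degree P) P"
  have Q: "mat_poly_rev (mat_poly_degree ?Q) ?Q = P"
    unfolding mat_poly_degree_mat_poly_rev[OF P ne]
    by (rule mat_poly_rev_mat_poly_rev[OF P degree_le_mat_poly_degree[OF P]])
  obtain X Y m where XY: "L = pencil X Y"
    "X \<in> carrier_mat (m + dim_row ?Q) (m + dim_col ?Q)" "Y \<in> carrier_mat (m + dim_row ?Q) (m + dim_col ?Q)"
    "is_linearization X Y ?Q" "is_linearization Y X P"
    using is_strong_linearization_carrier[OF L] Q by metis
  then show ?thesis
    unfolding is_strong_linearization_def using mat_poly_rev_pencil[OF XY(2,3)] by blast
qed

text \<open>The reversal at \<open>x\<close> is \<open>x ^ g\<close> times the original at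
  \<open>inverse x\<close>, and a nonzero factor does not change the kernel.\<close>

lemma right_eigenvector_mat_poly_rev:
  assumes M: "M \<in> carrier_mat r c" "\<And>i j. i < r \<Longrightarrow> j < c \<Longrightarrow> degree (M $$ (i, j)) \<le> g"
    and x: "x \<noteq> 0"
  shows "right_eigenvector (mat_poly_rev g M) x v \<longleftrightarrow> right_eigenvector M (inverse x) v"
proof -
  have E: "eval_mat_poly M (inverse x) \<in> carrier_mat r c" by (rule eval_mat_poly_carrier[OF M(1)])
  have "eval_mat_poly (mat_poly_rev g M) x = x ^ g \<cdot>\<^sub>m eval_mat_poly M (inverse x)"
    using M x by (intro eq_matI)
      (auto simp: eval_mat_poly_def mat_poly_rev_def poly_map_poly_to_ac_poly_rev)
  then have "eval_mat_poly (mat_poly_rev g M) x *\<^sub>v v = x ^ g \<cdot>\<^sub>v (eval_mat_poly M (inverse x) *\<^sub>v v)"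
    if "v \<in> carrier_vec c" using smult_mult_mat_vec[OF E that] by simp
  moreover have "k \<cdot>\<^sub>v w = 0\<^sub>v r \<longleftrightarrow> w = 0\<^sub>v r" if "k \<noteq> 0" "w \<in> carrier_vec r"
    for k :: "'a alg_closure" and w
    using that by (auto simp: vec_eq_iff)
  ultimately show ?thesis
    using M(1) x mult_mat_vec_carrier[OF E, of v]
    unfolding right_eigenvector_def by (simp add: mat_poly_rev_def cong: conj_cong)
qed

text \<open>The bounds keep the block inside \<open>v\<close>; entries of \<open>map_vec\<close>
  beyond the dimension are unspecified.\<close>

lemma map_vec_vec_block:
  assumes "v \<in> carrier_vec m" "k * n \<le> m" "1 \<le> k"
  shows "map_vec f (vec_block n k v) = vec_block n k (map_vec f v)"
proof (rule eq_vecI)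
  fix i assume "i < dim_vec (vec_block n k (map_vec f v))"
  then have i: "i < n" by (simp add: vec_block_def)
  have "(k - 1) * n + i < k * n" by (rule nat_block_less[OF _ i]) (use assms(3) in simp)
  then have "(k - 1) * n + i < dim_vec v" using assms by simp
  then show "map_vec f (vec_block n k v) $ i = vec_block n k (map_vec f v) $ i"
    using i by (simp add: vec_block_def)
qed (simp add: vec_block_def)

section \<open>Eigenvectors of the modified block Kronecker pencil\<close>

text \<open>Evaluation at \<open>c\<close> carries the polynomial identity and the block structure
  to the algebraic closure, where \<open>block_pencil_kernel\<close> applies.\<close>

lemma right_eigenvector_block:
  fixes A B P0 :: "'a :: field mat"
  assumes t: "t \<ge> 1" and \<sigma>: "\<sigma> \<noteq> 0"
    and P0: "P0 \<in> carrier_mat n n" "det P0 \<noteq> 0" and Q: "Q \<in> carrier_mat n n"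
    and K: "K \<in> carrier_mat ((t + 1) * n) ((t + 1) * n)"
    and dual: "(Lambda_hat_T t \<otimes>\<^sub>K 1\<^sub>m n) * K * (Lambda_hat t \<otimes>\<^sub>K 1\<^sub>m n) =
      four_block_mat (- const_mat P0) (monom 1 t \<cdot>\<^sub>m const_mat P0)
        (monom 1 t \<cdot>\<^sub>m const_mat P0) (Q - monom 1 (2 * t) \<cdot>\<^sub>m const_mat P0)"
    and z: "right_eigenvector (four_block_mat K ((L_hat t)\<^sup>T \<otimes>\<^sub>K 1\<^sub>m n)
        (([:\<sigma>:] \<cdot>\<^sub>m L_hat t) \<otimes>\<^sub>K 1\<^sub>m n) (0\<^sub>m ((t - 1) * n) ((t - 1) * n))) c z"
  shows "right_eigenvector Q c (vec_block n (t + 1) z)"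
proof -
  let ?e = "\<lambda>p :: 'a poly. poly (map_poly to_ac p) c"
  interpret ev: comm_ring_hom ?e by (rule map_poly_to_ac_eval_hom)
  interpret to_ac: comm_ring_hom "to_ac :: 'a \<Rightarrow> _" by unfold_locales auto
  obtain N M where N: "N = t + 1" and M: "M = t - 1" by blast
  note K = K[folded N]
  let ?P0 = "map_mat to_ac P0"
  have LT: "Lambda_hat_T t \<in> carrier_mat 2 N" and La: "Lambda_hat t \<in> carrier_mat N 2"
    and L: "(L_hat t :: 'a poly mat) \<in> carrier_mat M N"
    by (simp_all add: Lambda_hat_def Lambda_hat_T_def L_hat_def N M)
  have sL: "[:\<sigma>:] \<cdot>\<^sub>m L_hat t \<in> carrier_mat M N" and TL: "(L_hat t :: 'a poly mat)\<^sup>T \<in> carrier_mat N M"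
    using L by simp_all
  note k1 = kronecker_carrier[OF _ one_carrier_mat]
  note eval_defs = eval_mat_poly_def[symmetric]
  have evT: "map_mat ?e (Lambda_hat_T t) = (Lambda_hat_at t c)\<^sup>T"
    using map_mat_transpose[of ?e "Lambda_hat t"]
    by (simp add: eval_Lambda_hat eval_defs) (simp add: Lambda_hat_def)
  have "map_mat ?e ((Lambda_hat_T t \<otimes>\<^sub>K 1\<^sub>m n) * K * (Lambda_hat t \<otimes>\<^sub>K 1\<^sub>m n)) =
      ((Lambda_hat_at t c)\<^sup>T \<otimes>\<^sub>K 1\<^sub>m n) * eval_mat_poly K c * (Lambda_hat_at t c \<otimes>\<^sub>K 1\<^sub>m n)"
    unfolding ev.mat_hom_mult[OF mult_carrier_mat[OF k1[OF LT] K] k1[OF La]]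
      ev.mat_hom_mult[OF k1[OF LT] K] ev.mat_hom_kronecker evT ev.mat_hom_one
    by (simp add: eval_defs eval_Lambda_hat)
  moreover have "map_mat ?e (four_block_mat (- const_mat P0) (monom 1 t \<cdot>\<^sub>m const_mat P0)
        (monom 1 t \<cdot>\<^sub>m const_mat P0) (Q - monom 1 (2 * t) \<cdot>\<^sub>m const_mat P0)) =
      four_block_mat (- ?P0) (c ^ t \<cdot>\<^sub>m ?P0) (c ^ t \<cdot>\<^sub>m ?P0)
        (eval_mat_poly Q c - c ^ (2 * t) \<cdot>\<^sub>m ?P0)"
  proof -
    have neg: "map_mat ?e (- const_mat P0) = - ?P0"
      by (rule eq_matI) (auto simp: const_mat_def ev.hom_uminus poly_map_poly_to_ac_const simp del: minus_pCons)
    have smult: "map_mat ?e (monom 1 m \<cdot>\<^sub>m const_mat P0) = c ^ m \<cdot>\<^sub>m ?P0" for m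
      unfolding ev.smult_mat_hom
      by (simp add: eval_defs eval_const_mat map_poly_monom poly_monom)
    have diff: "map_mat ?e (Q - monom 1 (2 * t) \<cdot>\<^sub>m const_mat P0) =
        map_mat ?e Q - map_mat ?e (monom 1 (2 * t) \<cdot>\<^sub>m const_mat P0)"
      using Q P0 by (intro eq_matI) (auto simp: const_mat_def ev.hom_minus)
    have C: "const_mat P0 \<in> carrier_mat n n" using P0 by (simp add: const_mat_def)
    then have "- const_mat P0 \<in> carrier_mat n n" "monom 1 t \<cdot>\<^sub>m const_mat P0 \<in> carrier_mat n n"
      "Q - monom 1 (2 * t) \<cdot>\<^sub>m const_mat P0 \<in> carrier_mat n n"
      by (simp_all add: minus_carrier_mat)
    then show ?thesis
      by (simp only: map_four_block_mat neg smult diff) (simp only: eval_defs)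
  qed
  ultimately have dual': "((Lambda_hat_at t c)\<^sup>T \<otimes>\<^sub>K 1\<^sub>m n) * eval_mat_poly K c *
      (Lambda_hat_at t c \<otimes>\<^sub>K 1\<^sub>m n) = four_block_mat (- ?P0) (c ^ t \<cdot>\<^sub>m ?P0) (c ^ t \<cdot>\<^sub>m ?P0)
        (eval_mat_poly Q c - c ^ (2 * t) \<cdot>\<^sub>m ?P0)"
    using dual by simp
  let ?Lt = "four_block_mat K ((L_hat t)\<^sup>T \<otimes>\<^sub>K 1\<^sub>m n) (([:\<sigma>:] \<cdot>\<^sub>m L_hat t) \<otimes>\<^sub>K 1\<^sub>m n)
    (0\<^sub>m (M * n) (M * n))"
  have zero: "map_mat ?e (0\<^sub>m (M * n) (M * n)) = 0\<^sub>m (M * n) (M * n)"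
    by (rule eq_matI) auto
  have Lt: "eval_mat_poly ?Lt c = four_block_mat (eval_mat_poly K c) ((L_hat_at t c)\<^sup>T \<otimes>\<^sub>K 1\<^sub>m n)
      ((to_ac \<sigma> \<cdot>\<^sub>m L_hat_at t c) \<otimes>\<^sub>K 1\<^sub>m n) (0\<^sub>m (M * n) (M * n))"
    unfolding eval_mat_poly_def
      map_four_block_mat[OF K k1[OF TL] k1[OF sL] zero_carrier_mat]
      ev.mat_hom_kronecker ev.mat_hom_one map_mat_transpose[symmetric] ev.smult_mat_hom zero
    by (simp add: eval_defs eval_L_hat poly_map_poly_to_ac_const)
  have dim: "dim_row ?Lt = N * n + M * n" "dim_col ?Lt = N * n + M * n"
    using K by simp_all
  have zLt: "z \<in> carrier_vec (N * n + M * n)" "z \<noteq> 0\<^sub>v (N * n + M * n)"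
    "eval_mat_poly ?Lt c *\<^sub>v z = 0\<^sub>v (N * n + M * n)"
    using z unfolding right_eigenvector_def N[symmetric] M[symmetric] dim by blast+
  \<comment> \<open>The embedding is injective and commutes with determinants.\<close>
  have s: "to_ac \<sigma> \<noteq> 0" and d: "det ?P0 \<noteq> 0"
    using \<sigma> P0(2) by simp_all
  have P0': "?P0 \<in> carrier_mat n n" using P0 by simp
  note block = block_pencil_kernel[OF t eval_mat_poly_carrier[OF K, unfolded N] P0'
      eval_mat_poly_carrier[OF Q] d s dual' zLt(1,2)[unfolded N M] zLt(3)[unfolded Lt, unfolded N M]]
  show ?thesis
    using block Q unfolding right_eigenvector_def by (auto simp: vec_block_def)
qed

section \<open>Finite and infinite eigenvalues together\<close>

theorem theorem7p6:
  fixes P Lt L :: "'a :: field poly mat"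
    and A B :: "'a mat"
    and \<sigma> :: 'a
    and n d t :: nat
  assumes "P \<in> carrier_mat n n"
    and "regular_mat_poly P"
    and "mat_poly_degree P = d"
    and "even d" and "d \<ge> 2" and "t = d div 2"
    and "det (coeff_mat P 0) \<noteq> 0"
    and "A \<in> carrier_mat ((t + 1) * n) ((t + 1) * n)"
    and "B \<in> carrier_mat ((t + 1) * n) ((t + 1) * n)"
    and "\<sigma> \<in> {1, -1}"
    and "(Lambda_hat_T t \<otimes>\<^sub>K 1\<^sub>m n) * pencil B A * (Lambda_hat t \<otimes>\<^sub>K 1\<^sub>m n) =
      (let P0 = const_mat (coeff_mat P 0) in
       four_block_mat (- P0) (monom 1 t \<cdot>\<^sub>m P0)
         (monom 1 t \<cdot>\<^sub>m P0) (mat_poly_rev d P - monom 1 d \<cdot>\<^sub>m P0))"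
    and "Lt = four_block_mat
        (pencil B A) (transpose_mat (L_hat t) \<otimes>\<^sub>K 1\<^sub>m n)
        (([:\<sigma>:] \<cdot>\<^sub>m L_hat t) \<otimes>\<^sub>K 1\<^sub>m n) (0\<^sub>m ((t - 1) * n) ((t - 1) * n))"
    and "is_strong_linearization Lt (mat_poly_rev d P)"
    and "L = mat_poly_rev 1 Lt"
  shows "is_strong_linearization L P \<and>
    (\<forall>(z :: 'a vec) \<in> carrier_vec (n * d). \<forall>\<mu> :: 'a alg_closure.
       \<mu> \<noteq> 0 \<and> right_eigenvector L \<mu> (map_vec to_ac z) \<longrightarrow>
       right_eigenvector P \<mu> (map_vec to_ac (vec_block n (t + 1) z))) \<and>
    (\<forall>(z :: 'a vec) \<in> carrier_vec (n * d).
       right_eigenvector_inf 1 L (map_vec to_ac z) \<longrightarrow>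
       right_eigenvector_inf d P (map_vec to_ac (vec_block n (t + 1) z)))"
proof -
  have P: "P \<in> carrier_mat n n" and d: "mat_poly_degree P = d" by fact+
  have d2: "d = 2 * t" and t: "t \<ge> 1"
    using \<open>even d\<close> \<open>d \<ge> 2\<close> \<open>t = d div 2\<close> by auto
  have Pdeg: "degree (P $$ (i, j)) \<le> d" if "i < n" "j < n" for i j
    using degree_le_mat_poly_degree[OF P that] d by simp
  have P0: "coeff_mat P 0 \<in> carrier_mat n n" using P by (simp add: coeff_mat_def)
  \<comment> \<open>An empty matrix has determinant 1, so nonsingularity gives a nonzero
    \<open>coeff_mat P 0\<close> only once \<open>n\<close> is positive; the degree bound ensures
    this.\<close>
  have n: "n \<noteq> 0"
  proof
    assume "n = 0"
    then have "mat_poly_degree P \<le> 0" using P by (intro mat_poly_degree_le[of P 0 0]) simp_all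
    then show False using d \<open>d \<ge> 2\<close> by simp
  qed
  have ne: "coeff_mat P 0 \<noteq> 0\<^sub>m n n"
  proof
    assume "coeff_mat P 0 = 0\<^sub>m n n"
    then show False using \<open>det (coeff_mat P 0) \<noteq> 0\<close> n by simp
  qed
  have strong: "is_strong_linearization L P"
    unfolding \<open>L = mat_poly_rev 1 Lt\<close>
    using is_strong_linearization_rev[OF P ne] d \<open>is_strong_linearization Lt (mat_poly_rev d P)\<close>
    by simp

  \<comment> \<open>The pencil form of \<open>Lt\<close> bounds the degrees of its entries by 1, as
    needed for reversing twice.\<close>
  obtain X Y k where XY': "Lt = pencil X Y"
    "X \<in> carrier_mat (k + dim_row (mat_poly_rev d P)) (k + dim_col (mat_poly_rev d P))"
    "Y \<in> carrier_mat (k + dim_row (mat_poly_rev d P)) (k + dim_col (mat_poly_rev d P))"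
    using is_strong_linearization_carrier[OF \<open>is_strong_linearization Lt (mat_poly_rev d P)\<close>]
    by metis
  obtain m where m: "m = k + n" by blast
  have XY: "Lt = pencil X Y" "X \<in> carrier_mat m m" "Y \<in> carrier_mat m m"
    using XY' P by (simp_all add: m mat_poly_rev_def)
  have Lt: "Lt \<in> carrier_mat m m" unfolding XY(1) by (rule pencil_carrier[OF XY(2,3)])
  have Lt_deg: "degree (Lt $$ (i, j)) \<le> 1" if "i < m" "j < m" for i j
    unfolding XY(1) index_pencil[OF XY(2,3) that] by simp

  have Q: "mat_poly_rev d P \<in> carrier_mat n n" using P by (simp add: mat_poly_rev_def)
  have K: "pencil B A \<in> carrier_mat ((t + 1) * n) ((t + 1) * n)"
    by (rule pencil_carrier) fact+
  have \<sigma>: "\<sigma> \<noteq> 0" using \<open>\<sigma> \<in> {1, -1}\<close> by auto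
  have dual: "(Lambda_hat_T t \<otimes>\<^sub>K 1\<^sub>m n) * pencil B A * (Lambda_hat t \<otimes>\<^sub>K 1\<^sub>m n) =
      four_block_mat (- const_mat (coeff_mat P 0)) (monom 1 t \<cdot>\<^sub>m const_mat (coeff_mat P 0))
        (monom 1 t \<cdot>\<^sub>m const_mat (coeff_mat P 0))
        (mat_poly_rev d P - monom 1 (2 * t) \<cdot>\<^sub>m const_mat (coeff_mat P 0))"
    unfolding assms(11) Let_def d2 ..
  have block: "right_eigenvector (mat_poly_rev d P) c (vec_block n (t + 1) z)"
    if "right_eigenvector Lt c z" for c z
    using right_eigenvector_block[OF t \<sigma> P0 assms(7) Q K dual] that
    unfolding \<open>Lt = four_block_mat _ _ _ _\<close> by blast
  \<comment> \<open>As \<open>t + 1 \<le> 2 * t\<close>, the selected block lies inside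
    \<open>z\<close>.\<close>
  have "(t + 1) * n \<le> n * d" using t by (simp add: d2)
  then have vb: "map_vec to_ac (vec_block n (t + 1) z) = vec_block n (t + 1) (map_vec to_ac z)"
    if "z \<in> carrier_vec (n * d)" for z :: "'a vec"
    using that by (intro map_vec_vec_block) simp_all

  have "right_eigenvector P \<mu> (map_vec to_ac (vec_block n (t + 1) z))"
    if z: "z \<in> carrier_vec (n * d)" and \<mu>: "\<mu> \<noteq> 0" "right_eigenvector L \<mu> (map_vec to_ac z)"
    for z :: "'a vec" and \<mu>
  proof -
    \<comment> \<open>Two reversals: from \<open>L\<close> at \<open>\<mu>\<close> to
      \<open>Lt\<close> at \<open>inverse \<mu>\<close>, and after \<open>block\<close> from the
      reversed polynomial back to \<open>P\<close> at \<open>\<mu>\<close>.\<close>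
    have "right_eigenvector Lt (inverse \<mu>) (map_vec to_ac z)"
      using \<mu> right_eigenvector_mat_poly_rev[OF Lt Lt_deg] \<open>L = mat_poly_rev 1 Lt\<close> by simp
    then have "right_eigenvector (mat_poly_rev d P) (inverse \<mu>) (vec_block n (t + 1) (map_vec to_ac z))"
      by (rule block)
    then show ?thesis
      using \<mu>(1) right_eigenvector_mat_poly_rev[OF P Pdeg, of "inverse \<mu>"] vb[OF z] by simp
  qed
  moreover have "right_eigenvector_inf d P (map_vec to_ac (vec_block n (t + 1) z))"
    if z: "z \<in> carrier_vec (n * d)" and inf: "right_eigenvector_inf 1 L (map_vec to_ac z)"
    for z :: "'a vec"
  proof -
    \<comment> \<open>At infinity the definition itself supplies the second reversal, so
      \<open>block\<close> applies directly with \<open>c = 0\<close>.\<close>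
    have "mat_poly_rev 1 L = Lt"
      unfolding \<open>L = mat_poly_rev 1 Lt\<close> by (rule mat_poly_rev_mat_poly_rev[OF Lt Lt_deg])
    then have "right_eigenvector Lt 0 (map_vec to_ac z)"
      using inf by (simp add: right_eigenvector_inf_def)
    then show ?thesis
      unfolding right_eigenvector_inf_def vb[OF z] by (rule block)
  qed
  ultimately show ?thesis using strong by blast
qed

end
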